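(* Let $a,b\in\mathbb{R}$ with $0<a<b$. For all $q\ge 1$ and $p$ with $\frac1p+\frac1q=1$, put $$S=\sum_{i=1}^{2}\left[\left(\frac{q+3}{q+1}\right)^{i-1}\frac1{b^{2q}}+\left(\frac{q+3}{q+1}\right)^{2-i}\frac1{a^{2q}}\right]^{\frac1q}.$$ Then $$\left|\ln A(a,b)-\ln I(a,b)\right|\le\frac{(b-a)^2}{16}\left(\frac1{p+1}\right)^{\frac1p}\left(\frac1{2(q+2)}\right)^{\frac1q}S,$$ $$\left|\ln G(a,b)-\ln I(a,b)\right|\le\frac{(b-a)^2}{16}\left(\frac{2^{p+1}-1}{p+1}\right)^{\frac1p}\left(\frac1{2(q+2)}\right)^{\frac1q}S,$$ and $$\left|\tfrac13\ln G(a,b)+\tfrac23\ln A(a,b)-\ln I(a,b)\right|\le\frac{(b-a)^2}{48}\left(\frac{2^{p+1}-1}{3(p+1)}\right)^{\frac1p}\left(\frac1{2(q+2)}\right)^{\frac1q}S.$$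
   Context: For $0<a<b$: $A(a,b)=\frac{a+b}{2}$ (arithmetic mean), $G(a,b)=\sqrt{ab}$ (geometric mean), $I(a,b)=\frac1e\left(\frac{b^b}{a^a}\right)^{\frac1{b-a}}$ (identric mean). *)

theory Defs
  imports Complex_Main "HOL-Library.Extended_Real" "HOL-Real_Asymp.Real_Asymp"
begin

definition arithmetic_mean :: "real \<Rightarrow> real \<Rightarrow> real" where
  "arithmetic_mean a b = (a + b) / 2"

definition geometric_mean :: "real \<Rightarrow> real \<Rightarrow> real" where
  "geometric_mean a b = sqrt (a * b)"

definition identric_mean :: "real \<Rightarrow> real \<Rightarrow> real" where
  "identric_mean a b = 1 / exp 1 * ((b powr b / a powr a) powr (1 / (b - a)))"

(* The value of "c(p)^(1/p)" for an exponent p that may be infinite. At p = \<infinity>, the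
   Hoelder conjugate of q = 1, the expression stands for its limit as p tends to infinity;
   the lemmas below show that this limit exists for each factor that is used. *)
definition p_root :: "(real \<Rightarrow> real) \<Rightarrow> ereal \<Rightarrow> real" where
  "p_root c p =
     (if p = \<infinity> then Lim at_top (\<lambda>s. c s powr (1 / s))
      else c (real_of_ereal p) powr (1 / real_of_ereal p))"

lemma p_root_ereal: "p_root c (ereal p) = c p powr (1 / p)"
  by (simp add: p_root_def)

lemma p_root_infinity:
  assumes "((\<lambda>s. c s powr (1 / s)) \<longlongrightarrow> L) at_top"
  shows "p_root c \<infinity> = L"
  using assms by (simp add: p_root_def tendsto_Lim)

lemma p_root_infinity_midpoint: "p_root (\<lambda>s. 1 / (s + 1)) \<infinity> = 1"
  by (rule p_root_infinity) real_asymp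

lemma p_root_infinity_trapezoid: "p_root (\<lambda>s. (2 powr (s + 1) - 1) / (s + 1)) \<infinity> = 2"
  by (rule p_root_infinity) real_asymp

lemma p_root_infinity_simpson: "p_root (\<lambda>s. (2 powr (s + 1) - 1) / (3 * (s + 1))) \<infinity> = 2"
  by (rule p_root_infinity) real_asymp

definition S_sum :: "real \<Rightarrow> real \<Rightarrow> real \<Rightarrow> real" where
  "S_sum q a b =
     (\<Sum>i = 1..2::nat.
        (((q + 3) / (q + 1)) ^ (i - 1) * (1 / b powr (2 * q))
         + ((q + 3) / (q + 1)) ^ (2 - i) * (1 / a powr (2 * q))) powr (1 / q))"

end

(* With h = (b - a) / 2 and G(t) the sum of 1/x^2 over the two points x at distance (1 - t) h
   from the midpoint of [a, b], integration by parts gives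
     ln A - ln I             = h^2/4  * integral of t * t * G(t) over [0, 1],
     ln I - ln G             = h^2/4  * integral of (2 - t) * t * G(t),
     ln I - (ln G + 2 ln A)/3 = h^2/12 * integral of (2 - 3 t) * t * G(t).
   The first two integrals are bounded by Hoelder's inequality with the factors t (resp. 2 - t) in
   L^p and t/x^2 in L^q, together with the convexity of x^(-2q).  In the third one this would give
   the constant (2^(p+1) + 1) / (3 (p+1)), larger than the claimed one; instead, t (2 - 3 t) has
   mean zero, so the integral is at most (1/a^2 - 1/b^2) / 4, which is below the bound since the
   p-factor is at least 1/2 and the q-factor times S is at least 1 / (2 a^2). *)
theory Submission
  imports Defs "HOL-Analysis.Analysis"
begin

section \<open>Hoelder, Bernoulli, convex powers, and integrals of powers\<close>

lemma integral_mult_le_Hoelder: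
  fixes f g u v :: "real \<Rightarrow> real"
  assumes pq: "p > 1" "q > 1" "1/p + 1/q = 1"
    and J: "((\<lambda>t. f t * g t) has_integral J) X"
    and U: "(u has_integral U) X" "U > 0" and V: "(v has_integral V) X" "V > 0"
    and fu: "\<And>t. t \<in> X \<Longrightarrow> 0 \<le> f t" "\<And>t. t \<in> X \<Longrightarrow> f t powr p \<le> u t"
    and gv: "\<And>t. t \<in> X \<Longrightarrow> 0 \<le> g t" "\<And>t. t \<in> X \<Longrightarrow> g t powr q \<le> v t"
  shows "J \<le> U powr (1/p) * V powr (1/q)"
proof -
  \<comment> \<open>Dividing by \<open>M\<close> and \<open>N\<close> scales the majorants to
    \<open>u / U\<close> and \<open>v / V\<close>, both of integral 1, so integrating Young's
    inequality leaves the factor 1/p + 1/q = 1. Majorants replace the powers themselves so that a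
    convexity estimate can be plugged in as \<open>v\<close>.\<close>
  define M N where "M = U powr (1/p)" and "N = V powr (1/q)"
  have MN: "M > 0" "N > 0" "M powr p = U" "N powr q = V"
    using pq U V by (auto simp: M_def N_def powr_powr)
  have "((\<lambda>t. M * N * (u t / (p * U) + v t / (q * V))) has_integral
      M * N * (U / (p * U) + V / (q * V))) X"
    by (intro has_integral_mult_right has_integral_add has_integral_divide U V)
  moreover have "f t * g t \<le> M * N * (u t / (p * U) + v t / (q * V))" if "t \<in> X" for t
  proof -
    have "(f t / M) * (g t / N) \<le> (f t / M) powr p / p + (g t / N) powr q / q"
      using pq fu(1)[OF that] gv(1)[OF that] MN by (intro Youngs_inequality) auto
    also have "\<dots> = f t powr p / U / p + g t powr q / V / q"
      using fu(1)[OF that] gv(1)[OF that] MN by (simp add: powr_divide)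
    also have "\<dots> \<le> u t / U / p + v t / V / q"
      using fu(2)[OF that] gv(2)[OF that] pq U V
      by (intro add_mono divide_right_mono) auto
    finally have "M * N * ((f t / M) * (g t / N)) \<le> M * N * (u t / U / p + v t / V / q)"
      using MN by (intro mult_left_mono) auto
    then show ?thesis using MN by (simp add: field_simps)
  qed
  ultimately have "J \<le> M * N * (U / (p * U) + V / (q * V))"
    using has_integral_le[OF J] by blast
  also have "\<dots> = M * N * (1/p + 1/q)" using U V by simp
  finally show ?thesis using pq by (simp add: M_def N_def)
qed

text \<open>Bernoulli's inequality for real exponents: weighted AM-GM for 1 + p x and 1 with weights
  1/p and 1 - 1/p, raised to the power p.\<close>

lemma one_add_mult_le_powr:
  fixes x p :: real
  assumes "1 \<le> p" "0 \<le> x"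
  shows "1 + p * x \<le> (1 + x) powr p"
proof -
  have pos: "1 + p * x > 0" using assms by (simp add: add_pos_nonneg)
  have "(1 + p * x) powr (1/p) * 1 powr (1 - 1/p) \<le> 1/p * (1 + p * x) + (1 - 1/p) * 1"
    using assms pos by (intro Youngs_inequality_0) auto
  also have "\<dots> = 1 + x" using assms by (simp add: field_simps)
  finally have "((1 + p * x) powr (1/p)) powr p \<le> (1 + x) powr p"
    using assms by (intro powr_mono2) auto
  then show ?thesis using assms pos by (simp add: powr_powr)
qed

lemma convex_on_powr_neg:
  fixes s :: real
  assumes "s \<le> 0"
  shows "convex_on {0<..} (\<lambda>x. x powr s)"
proof (rule f''_ge0_imp_convex)
  show "DERIV (\<lambda>x. x powr s) x :> s * x powr (s - 1)" if "x \<in> {0<..}" for x :: real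
    using that by (auto intro!: derivative_eq_intros)
  show "DERIV (\<lambda>x. s * x powr (s - 1)) x :> s * ((s - 1) * x powr (s - 2))"
    if "x \<in> {0<..}" for x :: real
    using that by (auto intro!: derivative_eq_intros)
  show "0 \<le> s * ((s - 1) * x powr (s - 2))" for x :: real
    using assms by (simp add: mult_nonpos_nonpos mult_nonpos_nonneg)
qed auto

text \<open>The base may vanish at one endpoint, so the primitive is differentiated only in the
  interior and is merely continuous at the ends. The instances wanted are powers of t and of 2 -
  t.\<close>

lemma has_integral_affine_powr:
  fixes c d s :: real
  assumes "0 < s" "d \<noteq> 0" "0 \<le> c" "0 \<le> c + d"
  shows "((\<lambda>t. (c + d * t) powr s) has_integral
    ((c + d) powr (s + 1) - c powr (s + 1)) / (d * (s + 1))) {0..1}"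
proof -
  define F where "F = (\<lambda>t. (c + d * t) powr (s + 1) / (d * (s + 1)))"
  have pos: "0 < c + d * t" if "t \<in> {0<..<1}" for t
  proof -
    have "c + d * t = (1 - t) * c + t * (c + d)" by (simp add: algebra_simps)
    moreover have "0 \<le> (1 - t) * c" "0 \<le> t * (c + d)" using assms that by auto
    moreover have "0 < (1 - t) * c \<or> 0 < t * (c + d)" using assms that by (cases "c = 0") auto
    ultimately show ?thesis by linarith
  qed
  have nonneg: "0 \<le> c + d * t" if "t \<in> {0..1}" for t
    using pos[of t] that assms by (cases "t = 0"; cases "t = 1") auto
  have "((\<lambda>t. (c + d * t) powr s) has_integral F 1 - F 0) {0..1}"
  proof (rule fundamental_theorem_of_calculus_interior)
    show "continuous_on {0..1} F"
      unfolding F_def using assms nonneg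
      by (intro continuous_intros continuous_on_powr') auto
    fix t :: real assume t: "t \<in> {0<..<1}"
    have "((\<lambda>t. (c + d * t) powr (s + 1)) has_real_derivative (c + d * t) powr s * (d * (s + 1))) (at t)"
      using pos[OF t] by (auto intro!: derivative_eq_intros)
    from DERIV_cdivide[OF this, of "d * (s + 1)"]
    have "(F has_real_derivative (c + d * t) powr s) (at t)"
      unfolding F_def using assms by simp
    then show "(F has_vector_derivative (c + d * t) powr s) (at t)"
      by (simp add: has_real_derivative_iff_has_vector_derivative)
  qed simp
  then show ?thesis by (simp add: F_def diff_divide_distrib)
qed

section \<open>The path from an endpoint to the midpoint, and moments of 1/x^2 along it\<close>

definition half_segment :: "real \<Rightarrow> real \<Rightarrow> real \<Rightarrow> real" where
  "half_segment c e t = (1 - t / 2) * c + t / 2 * e"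

lemma half_segment_pos:
  assumes "0 < c" "0 < e" "t \<in> {0..1}"
  shows "0 < half_segment c e t"
  unfolding half_segment_def using assms by (intro add_pos_nonneg) auto

lemma has_integral_half_segment_1:
  fixes c e :: real
  assumes "0 < c" "0 < e" "c \<noteq> e"
  shows "((\<lambda>t. t / (half_segment c e t)\<^sup>2) has_integral
    (ln ((c + e) / 2) - ln c + 2 * c / (c + e) - 1) / ((e - c) / 2)\<^sup>2) {0..1}"
proof -
  define d where "d = (e - c) / 2"
  define x where "x = half_segment c e"
  have x: "x = (\<lambda>t. c + d * t)"
    by (auto simp: x_def half_segment_def d_def field_simps)
  \<comment> \<open>Substituting t = (x - c)/d turns t/x^2 dt into (1/x - c/x^2) dx / d^2.\<close>
  define F where "F = (\<lambda>t. (ln (x t) + c / x t) / d\<^sup>2)"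
  have d: "d \<noteq> 0" using assms by (simp add: d_def)
  have int: "((\<lambda>t. t / (x t)\<^sup>2) has_integral F 1 - F 0) {0..1}"
  proof (rule fundamental_theorem_of_calculus)
    fix t :: real assume t: "t \<in> {0..1}"
    have pos: "c + d * t > 0" using half_segment_pos[OF assms(1,2) t] x by (metis x_def)
    have "(F has_real_derivative (d / (c + d * t) - c * d / (c + d * t)\<^sup>2) / d\<^sup>2) (at t within {0..1})"
      unfolding F_def x using pos d
      by (auto intro!: derivative_eq_intros simp: power2_eq_square)
    also have "(d / (c + d * t) - c * d / (c + d * t)\<^sup>2) / d\<^sup>2 = t / (x t)\<^sup>2"
      unfolding x using pos d by (simp add: divide_simps power2_eq_square) (simp add: algebra_simps)
    finally show "(F has_vector_derivative t / (x t)\<^sup>2) (at t within {0..1})"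
      by (simp add: has_real_derivative_iff_has_vector_derivative)
  qed simp
  have "x 1 = (c + e) / 2" "x 0 = c" by (auto simp: x d_def field_simps)
  moreover have "c / ((c + e) / 2) = 2 * c / (c + e)" by simp
  ultimately have "F 1 - F 0 = (ln ((c + e) / 2) - ln c + 2 * c / (c + e) - 1) / d\<^sup>2"
    using assms unfolding F_def by (simp only: diff_divide_distrib[symmetric]) simp
  with int show ?thesis by (simp add: x_def d_def)
qed

lemma has_integral_half_segment_2:
  fixes c e :: real
  assumes "0 < c" "0 < e" "c \<noteq> e"
  shows "((\<lambda>t. t\<^sup>2 / (half_segment c e t)\<^sup>2) has_integral
    (1 + 2 * c / (c + e) - 2 * c * (ln ((c + e) / 2) - ln c) / ((e - c) / 2)) / ((e - c) / 2)\<^sup>2) {0..1}"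
proof -
  define d where "d = (e - c) / 2"
  define x where "x = half_segment c e"
  have x: "x = (\<lambda>t. c + d * t)"
    by (auto simp: x_def half_segment_def d_def field_simps)
  \<comment> \<open>The same substitution gives (1 - 2 c/x + c^2/x^2) dx / d^3.\<close>
  define F where "F = (\<lambda>t. (x t - 2 * c * ln (x t) - c\<^sup>2 / x t) / d ^ 3)"
  have d: "d \<noteq> 0" using assms by (simp add: d_def)
  have "((\<lambda>t. t\<^sup>2 / (x t)\<^sup>2) has_integral F 1 - F 0) {0..1}"
  proof (rule fundamental_theorem_of_calculus)
    fix t :: real assume t: "t \<in> {0..1}"
    have pos: "c + d * t > 0" using half_segment_pos[OF assms(1,2) t] x by (metis x_def)
    have "(F has_real_derivative (d - 2 * c * (d / (c + d * t)) + c\<^sup>2 * d / (c + d * t)\<^sup>2) / d ^ 3)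
        (at t within {0..1})"
      unfolding F_def x using pos d
      by (intro DERIV_cdivide) (auto intro!: derivative_eq_intros simp: power2_eq_square)
    also have "(d - 2 * c * (d / (c + d * t)) + c\<^sup>2 * d / (c + d * t)\<^sup>2) / d ^ 3 = t\<^sup>2 / (x t)\<^sup>2"
      unfolding x using pos d
      by (simp add: divide_simps power2_eq_square power3_eq_cube) (simp add: algebra_simps)
    finally show "(F has_vector_derivative t\<^sup>2 / (x t)\<^sup>2) (at t within {0..1})"
      by (simp add: has_real_derivative_iff_has_vector_derivative)
  qed simp
  moreover have x01: "x 1 = (c + e) / 2" "x 0 = c" by (auto simp: x d_def field_simps)
  have "F 1 - F 0 = (1 + 2 * c / (c + e) - 2 * c * (ln ((c + e) / 2) - ln c) / d) / d\<^sup>2"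
  proof -
    \<comment> \<open>With m = (c + e)/2 the left side is (m - c)(m + c)/m, and m - c =
      \<open>d\<close>; this factor \<open>d\<close> later lowers the denominator from d^3 to
      d^2.\<close>
    have "(c + e) / 2 - c\<^sup>2 / ((c + e) / 2) = d * (1 + 2 * c / (c + e))"
      using assms by (simp add: d_def field_simps power2_eq_square)
    then have "F 1 = (d * (1 + 2 * c / (c + e)) - 2 * c * ln ((c + e) / 2)) / d ^ 3"
      by (simp add: F_def x01 algebra_simps)
    moreover have "F 0 = (- 2 * c * ln c) / d ^ 3"
      using assms by (simp add: F_def x01 power2_eq_square)
    ultimately have "F 1 - F 0 = (d * (1 + 2 * c / (c + e)) - 2 * c * (ln ((c + e) / 2) - ln c)) / d ^ 3"
      by (simp only: diff_divide_distrib[symmetric]) (simp add: algebra_simps)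
    also have "\<dots> = (1 + 2 * c / (c + e) - 2 * c * (ln ((c + e) / 2) - ln c) / d) / d\<^sup>2"
      using d by (simp add: diff_divide_distrib power2_eq_square power3_eq_cube)
    finally show ?thesis .
  qed
  ultimately show ?thesis by (simp add: x_def d_def)
qed

section \<open>Hoelder bounds on one half of the interval\<close>

definition half_bound :: "real \<Rightarrow> real \<Rightarrow> real \<Rightarrow> real" where
  "half_bound q c e = (1 / (2 * (q + 2))) powr (1 / q) *
     ((q + 3) / (q + 1) * (1 / c powr (2 * q)) + 1 / e powr (2 * q)) powr (1 / q)"

text \<open>\<open>half_bound q c e\<close> bounds the L^q norm of t/x^2 along the half starting at
  \<open>c\<close>. The summand i = 1 of S belongs to the half at \<open>a\<close>, the summand i =
  2 to the half at \<open>b\<close>.\<close>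

lemma S_sum_half_bound:
  "(1 / (2 * (q + 2))) powr (1 / q) * S_sum q a b = half_bound q a b + half_bound q b a"
proof -
  have "{1..2::nat} = {1, 2}" by auto
  then show ?thesis
    by (simp add: S_sum_def half_bound_def distrib_left add.commute)
qed

lemma inverse_square_half_segment_powr_le:
  fixes c e q :: real
  assumes "0 < c" "0 < e" "1 \<le> q" "t \<in> {0..1}"
  shows "(1 / (half_segment c e t)\<^sup>2) powr q
    \<le> (1 - t / 2) * (1 / c powr (2 * q)) + t / 2 * (1 / e powr (2 * q))"
proof -
  have eq: "1 / x powr (2 * q) = x powr (- 2 * q)" "(1 / x\<^sup>2) powr q = x powr (- 2 * q)"
    if "x > 0" for x :: real
  proof -
    show "1 / x powr (2 * q) = x powr (- 2 * q)" by (simp add: powr_minus_divide)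
    have "1 / x\<^sup>2 = x powr (- 2)" using that by (simp add: powr_minus_divide)
    then show "(1 / x\<^sup>2) powr q = x powr (- 2 * q)" by (simp add: powr_powr)
  qed
  \<comment> \<open>\<open>half_segment\<close> is by definition the convex combination of
    \<open>c\<close> and \<open>e\<close> with weights 1 - t/2 and t/2, so convexity of x^(-2q)
    applies directly.\<close>
  have "half_segment c e t powr (- 2 * q) \<le> (1 - t / 2) * c powr (- 2 * q) + t / 2 * e powr (- 2 * q)"
    using convex_onD[OF convex_on_powr_neg[of "- 2 * q"], of "t / 2" c e] assms
    by (simp add: half_segment_def)
  then show ?thesis
    using assms half_segment_pos[OF assms(1,2,4)] by (simp add: eq)
qed

text \<open>Source of the constants in S: the coefficient of \<open>C\<close> is 1/(q+1) -
  1/(2(q+2)) = (q+3)/(2(q+1)(q+2)), and that of \<open>E\<close> is 1/(2(q+2)).\<close>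

lemma has_integral_half_weight:
  fixes C E q :: real
  assumes "1 \<le> q"
  shows "((\<lambda>t. t powr q * ((1 - t / 2) * C + t / 2 * E)) has_integral
    1 / (2 * (q + 2)) * ((q + 3) / (q + 1) * C + E)) {0..1}"
proof -
  have "((\<lambda>t. C * t powr q + (E - C) / 2 * t powr (q + 1)) has_integral
      C * (1 / (q + 1)) + (E - C) / 2 * (1 / (q + 2))) {0..1}"
    using has_integral_affine_powr[of q 1 0] has_integral_affine_powr[of "q + 1" 1 0] assms
    by (intro has_integral_add has_integral_mult_right) (simp_all add: add.commute)
  also have "C * (1 / (q + 1)) + (E - C) / 2 * (1 / (q + 2))
      = 1 / (2 * (q + 2)) * ((q + 3) / (q + 1) * C + E)"
    using assms by (simp add: divide_simps) (simp add: algebra_simps)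
  finally show ?thesis
    by (rule has_integral_eq[rotated]) (auto simp: powr_add field_simps)
qed

lemma half_segment_Hoelder:
  fixes c e p q :: real
  assumes ce: "0 < c" "0 < e" and pq: "p > 1" "q > 1" "1 / p + 1 / q = 1"
    and k: "\<And>t. t \<in> {0..1} \<Longrightarrow> 0 \<le> k t"
    and J: "((\<lambda>t. k t * (t / (half_segment c e t)\<^sup>2)) has_integral J) {0..1}"
    and U: "((\<lambda>t. k t powr p) has_integral U) {0..1}" "U > 0"
  shows "J \<le> U powr (1 / p) * half_bound q c e"
proof -
  define C E where "C = 1 / c powr (2 * q)" and "E = 1 / e powr (2 * q)"
  have CE: "C > 0" "E > 0" using ce by (auto simp: C_def E_def)
  define V where "V = 1 / (2 * (q + 2)) * ((q + 3) / (q + 1) * C + E)"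
  have "J \<le> U powr (1 / p) * V powr (1 / q)"
  proof (rule integral_mult_le_Hoelder[OF pq J U])
    show "((\<lambda>t. t powr q * ((1 - t / 2) * C + t / 2 * E)) has_integral V) {0..1}"
      unfolding V_def using pq by (intro has_integral_half_weight) auto
    show "V > 0" unfolding V_def using pq CE by (intro mult_pos_pos add_pos_pos divide_pos_pos) auto
    fix t :: real assume t: "t \<in> {0..1}"
    have "(t / (half_segment c e t)\<^sup>2) powr q = t powr q * (1 / (half_segment c e t)\<^sup>2) powr q"
      using t by (simp add: powr_divide)
    also have "\<dots> \<le> t powr q * ((1 - t / 2) * C + t / 2 * E)"
      unfolding C_def E_def using ce pq t
      by (intro mult_left_mono inverse_square_half_segment_powr_le) auto
    finally show "(t / (half_segment c e t)\<^sup>2) powr q \<le> t powr q * ((1 - t / 2) * C + t / 2 * E)" .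
  qed (use k in auto)
  also have "V powr (1 / q) = half_bound q c e"
    unfolding V_def half_bound_def C_def[symmetric] E_def[symmetric]
    using pq CE by (subst powr_mult) (auto intro!: add_nonneg_nonneg)
  finally show ?thesis .
qed

text \<open>The limiting case q = 1 of the Hoelder bound: the L^p norm of \<open>k\<close> is
  replaced by an upper bound of \<open>k\<close>.\<close>

lemma half_segment_sup_bound:
  fixes c e N :: real
  assumes ce: "0 < c" "0 < e"
    and k: "\<And>t. t \<in> {0..1} \<Longrightarrow> k t \<le> N" and N: "0 \<le> N"
    and J: "((\<lambda>t. k t * (t / (half_segment c e t)\<^sup>2)) has_integral J) {0..1}"
  shows "J \<le> N * half_bound 1 c e"
proof -
  define C E where "C = 1 / c powr (2 * 1)" and "E = 1 / e powr (2 * 1)"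
  have CE: "C > 0" "E > 0" using ce by (auto simp: C_def E_def)
  have "((\<lambda>t. N * (t powr 1 * ((1 - t / 2) * C + t / 2 * E))) has_integral
      N * (1 / (2 * (1 + 2)) * ((1 + 3) / (1 + 1) * C + E))) {0..1}"
    by (intro has_integral_mult_right has_integral_half_weight) auto
  moreover have "k t * (t / (half_segment c e t)\<^sup>2) \<le> N * (t powr 1 * ((1 - t / 2) * C + t / 2 * E))"
    if t: "t \<in> {0..1}" for t
  proof -
    have "t * (1 / (half_segment c e t)\<^sup>2) \<le> t * ((1 - t / 2) * C + t / 2 * E)"
      using inverse_square_half_segment_powr_le[OF ce, of 1 t] t
      by (intro mult_left_mono) (auto simp: C_def E_def)
    then have "N * (t * (1 / (half_segment c e t)\<^sup>2)) \<le> N * (t * ((1 - t / 2) * C + t / 2 * E))"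
      using N by (rule mult_left_mono)
    moreover have "k t * (t / (half_segment c e t)\<^sup>2) \<le> N * (t / (half_segment c e t)\<^sup>2)"
      using k[OF t] t by (intro mult_right_mono) auto
    ultimately show ?thesis using t by simp
  qed
  ultimately have "J \<le> N * (1 / (2 * (1 + 2)) * ((1 + 3) / (1 + 1) * C + E))"
    using has_integral_le[OF J] by blast
  also have "\<dots> = N * half_bound 1 c e"
    using CE by (simp add: half_bound_def C_def E_def)
  finally show ?thesis .
qed

text \<open>Treats finite and infinite \<open>p\<close> together. For finite \<open>p\<close> the
  factor \<open>p_root U p\<close> is the L^p norm of \<open>k\<close>; for p = \<infinity>, which
  forces q = 1, it is a limit that dominates \<open>k\<close> by \<open>sup\<close>.\<close>

lemma half_segment_p_root_bound:
  fixes c e q :: real and p :: ereal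
  assumes ce: "0 < c" "0 < e" and pq: "1 \<le> q" "1 \<le> p" "1 / p + 1 / ereal q = 1"
    and k: "\<And>t. t \<in> {0..1} \<Longrightarrow> 0 \<le> k t"
    and J: "((\<lambda>t. k t * (t / (half_segment c e t)\<^sup>2)) has_integral J) {0..1}"
    and U: "\<And>s. s > 1 \<Longrightarrow> ((\<lambda>t. k t powr s) has_integral U s) {0..1}" "\<And>s. s > 1 \<Longrightarrow> U s > 0"
    and sup: "\<And>t. t \<in> {0..1} \<Longrightarrow> k t \<le> p_root U \<infinity>"
  shows "J \<le> p_root U p * half_bound q c e"
proof (cases p)
  case (real r)
  then have r: "1 \<le> r" "1 / r + 1 / q = 1" using pq
    by (auto simp: one_ereal_def)
  \<comment> \<open>If one of the exponents were 1, the reciprocal of the other would be 0, which is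
    impossible for finite exponents \<ge> 1.\<close>
  have "q \<noteq> 1" "r \<noteq> 1" using r pq by auto
  then have "r > 1" "q > 1" using r pq by auto
  then show ?thesis
    using half_segment_Hoelder[OF ce \<open>r > 1\<close> \<open>q > 1\<close> r(2) k J U(1) U(2)] real
    by (simp add: p_root_ereal)
next
  case PInf
  then have "q = 1" using pq by (auto simp: one_ereal_def)
  \<comment> \<open>The values at t = 0 show that the limit is nonnegative, as it is at least
    \<open>k 0\<close>.\<close>
  then show ?thesis
    using half_segment_sup_bound[OF ce sup _ J] k[of 0] sup[of 0] PInf by auto
qed (use pq in auto)

section \<open>The mean-zero kernel t (2 - 3 t), and lower bounds for the Simpson right-hand
  side\<close>

lemma half_segment_Simpson_bound:
  fixes c e :: real
  assumes ce: "0 < c" "0 < e"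
    and J: "((\<lambda>t. (2 - 3 * t) * (t / (half_segment c e t)\<^sup>2)) has_integral J) {0..1}"
  shows "\<bar>J\<bar> \<le> \<bar>1 / c\<^sup>2 - 1 / ((c + e) / 2)\<^sup>2\<bar> / 4"
proof -
  define m where "m = (c + e) / 2"
  \<comment> \<open>Centre and radius of the range of 1/x^2 between \<open>c\<close> and
    \<open>m\<close>. As \<open>K\<close> has mean zero, 1/x^2 may be replaced by its deviation from
    \<open>\<gamma>\<close>, so |J| is at most \<open>\<delta>\<close> times the integral of
    |K|.\<close>
  define \<gamma> \<delta> where "\<gamma> = (1 / c\<^sup>2 + 1 / m\<^sup>2) / 2" and "\<delta> = \<bar>1 / c\<^sup>2 - 1 / m\<^sup>2\<bar> / 2"
  define K where "K = (\<lambda>t::real. t * (2 - 3 * t))"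
  \<comment> \<open>The primitive t^2 - t^3 vanishes at both ends.\<close>
  have "(K has_integral (1\<^sup>2 - 1 ^ 3) - (0\<^sup>2 - 0 ^ 3)) {0..1}"
    unfolding K_def
    by (intro fundamental_theorem_of_calculus)
       (auto intro!: derivative_eq_intros simp: has_real_derivative_iff_has_vector_derivative[symmetric]
         algebra_simps power2_eq_square)
  then have "((\<lambda>t. \<gamma> * K t) has_integral \<gamma> * 0) {0..1}"
    by (intro has_integral_mult_right) simp
  from has_integral_diff[OF J this]
  have "((\<lambda>t. (2 - 3 * t) * (t / (half_segment c e t)\<^sup>2) - \<gamma> * K t) has_integral J) {0..1}"
    by simp
  then have JK: "((\<lambda>t. K t * (1 / (half_segment c e t)\<^sup>2 - \<gamma>)) has_integral J) {0..1}"
    by (rule has_integral_eq[rotated]) (simp add: K_def right_diff_distrib diff_divide_distrib mult_ac)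
  \<comment> \<open>The polynomial K^2 + 1/4 dominates |K|, which avoids splitting at the sign
    change t = 2/3. Its integral 2/15 + 1/4 = 23/60 is still below the 1/2 that suffices.\<close>
  have "((\<lambda>t. (K t)\<^sup>2 + 1 / 4) has_integral
      (4 / 3 * 1 ^ 3 - 3 * 1 ^ 4 + 9 / 5 * 1 ^ 5 + 1 / 4 * 1)
      - (4 / 3 * 0 ^ 3 - 3 * 0 ^ 4 + 9 / 5 * 0 ^ 5 + 1 / 4 * 0)) {0..1::real}"
    unfolding K_def
    by (intro fundamental_theorem_of_calculus)
       (auto intro!: derivative_eq_intros simp: has_real_derivative_iff_has_vector_derivative[symmetric]
         algebra_simps power2_eq_square eval_nat_numeral)
  then have B: "((\<lambda>t. \<delta> * ((K t)\<^sup>2 + 1 / 4)) has_integral \<delta> * (23 / 60)) {0..1}"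
    by (intro has_integral_mult_right) simp
  have le: "\<bar>K t * (1 / (half_segment c e t)\<^sup>2 - \<gamma>)\<bar> \<le> \<delta> * ((K t)\<^sup>2 + 1 / 4)" if t: "t \<in> {0..1}" for t
  proof -
    have "0 \<le> (\<bar>K t\<bar> - 1 / 2)\<^sup>2" by simp
    then have "\<bar>K t\<bar> \<le> (K t)\<^sup>2 + 1 / 4" by (simp add: power2_diff power_divide)
    moreover have "\<bar>1 / (half_segment c e t)\<^sup>2 - \<gamma>\<bar> \<le> \<delta>"
    proof -
      define x where "x = half_segment c e t"
      have x: "x = (1 - t) * c + t * m" by (simp add: x_def half_segment_def m_def field_simps)
      have m: "m > 0" using ce by (simp add: m_def)
      have mono: "1 / v\<^sup>2 \<le> 1 / u\<^sup>2" if "0 < u" "u \<le> v" for u v :: real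
        using that by (simp add: frac_le power_mono)
      \<comment> \<open>Both orders of \<open>c\<close> and \<open>m\<close> occur, since the bound
        serves the left and the right half. The lower bounds come from the upper ones by
        negation.\<close>
      consider "c \<le> x" "x \<le> m" | "m \<le> x" "x \<le> c"
        using convex_bound_le[of c m m "1 - t" t] convex_bound_le[of c c m "1 - t" t]
          convex_bound_le[of "-c" "-m" "-m" "1 - t" t] convex_bound_le[of "-c" "-c" "-m" "1 - t" t] t x
        by (cases "c \<le> m") auto
      then have "1 / m\<^sup>2 \<le> 1 / x\<^sup>2 \<and> 1 / x\<^sup>2 \<le> 1 / c\<^sup>2 \<or> 1 / c\<^sup>2 \<le> 1 / x\<^sup>2 \<and> 1 / x\<^sup>2 \<le> 1 / m\<^sup>2"
        using mono ce m by cases auto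
      then show ?thesis unfolding \<gamma>_def \<delta>_def x_def[symmetric] by (auto simp: abs_if field_simps)
    qed
    ultimately have "\<bar>K t\<bar> * \<bar>1 / (half_segment c e t)\<^sup>2 - \<gamma>\<bar> \<le> ((K t)\<^sup>2 + 1 / 4) * \<delta>"
      by (intro mult_mono) auto
    then show ?thesis by (simp add: abs_mult mult.commute)
  qed
  have "\<bar>J\<bar> \<le> \<delta> * (23 / 60)"
    using has_integral_le[OF JK B] has_integral_le[OF has_integral_neg[OF JK] B] le
    by (fastforce simp: abs_le_iff)
  also have "\<dots> \<le> \<delta> / 2" by (simp add: \<delta>_def)
  finally show ?thesis by (simp add: \<delta>_def m_def)
qed

text \<open>1/3 and 1/6 are the coefficients of \<open>C\<close> and \<open>E\<close> in
  \<open>V\<close> at q = 1. For larger q, Bernoulli gives 3^q \<ge> 1 + 2q and 6^q \<ge> 1 + 5q, so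
  these coefficients stay above 3^(-q) and 6^(-q); then the q-th root is taken.\<close>

lemma half_bound_ge:
  assumes "0 < c" "0 < e" "1 \<le> q"
  shows "1 / (3 * c\<^sup>2) \<le> half_bound q c e" and "1 / (6 * e\<^sup>2) \<le> half_bound q c e"
proof -
  define C E where "C = 1 / c powr (2 * q)" and "E = 1 / e powr (2 * q)"
  have CE: "C > 0" "E > 0" using assms by (auto simp: C_def E_def)
  define V where "V = 1 / (2 * (q + 2)) * ((q + 3) / (q + 1) * C + E)"
  have V: "half_bound q c e = V powr (1 / q)"
    unfolding V_def half_bound_def C_def[symmetric] E_def[symmetric]
    using assms CE by (subst powr_mult) (auto intro!: add_nonneg_nonneg)
  have root: "1 / (k * x\<^sup>2) \<le> V powr (1 / q)"
    if "1 / (k powr q) * (1 / x powr (2 * q)) \<le> V" "k > 0" "x > 0" for k x :: real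
  proof -
    have "1 / (k * x\<^sup>2) = (1 / (k powr q) * (1 / x powr (2 * q))) powr (1 / q)"
      using that assms by (simp add: powr_divide powr_mult powr_powr)
    also have "\<dots> \<le> V powr (1 / q)" using that assms by (intro powr_mono2) auto
    finally show ?thesis .
  qed
  have "1 + q * 2 \<le> 3 powr q" using one_add_mult_le_powr[of q 2] assms by simp
  then have "1 / (3 powr q) \<le> 1 / (1 + 2 * q)" using assms by (intro divide_left_mono) auto
  also have "\<dots> \<le> 1 / (2 * (q + 2)) * ((q + 3) / (q + 1))"
  proof -
    \<comment> \<open>The right side exceeds the left by exactly q - 1.\<close>
    have "2 * (q + 2) * (q + 1) \<le> (q + 3) * (1 + 2 * q)" using assms by (simp add: algebra_simps)
    then show ?thesis using assms by (simp add: divide_simps)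
  qed
  finally have "1 / (3 powr q) * C \<le> 1 / (2 * (q + 2)) * ((q + 3) / (q + 1)) * C"
    using CE by (intro mult_right_mono) auto
  also have "\<dots> \<le> V" unfolding V_def distrib_left mult.assoc[symmetric]
    using CE assms by (intro add_increasing2) auto
  finally show "1 / (3 * c\<^sup>2) \<le> half_bound q c e"
    unfolding V C_def using assms by (intro root) auto
  have "1 + q * 5 \<le> 6 powr q" using one_add_mult_le_powr[of q 5] assms by simp
  then have "1 / (6 powr q) \<le> 1 / (2 * (q + 2))" using assms by (intro divide_left_mono) auto
  then have "1 / (6 powr q) * E \<le> 1 / (2 * (q + 2)) * E"
    using CE by (intro mult_right_mono) auto
  also have "\<dots> \<le> V" unfolding V_def distrib_left mult.assoc[symmetric]
    using CE assms by (intro add_increasing) auto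
  finally show "1 / (6 * e\<^sup>2) \<le> half_bound q c e"
    unfolding V E_def using assms by (intro root) auto
qed

text \<open>For finite r, x = 2^r satisfies x \<ge> 1 + r by Bernoulli and 2x - 1 \<ge> 3, so the
  expression under the root is at least 2^(-r). At infinity the value is 2.\<close>

lemma p_root_Simpson_ge:
  assumes "1 \<le> p"
  shows "1 / 2 \<le> p_root (\<lambda>s. (2 powr (s + 1) - 1) / (3 * (s + 1))) p"
proof (cases p)
  case (real r)
  then have r: "1 \<le> r" using assms by (simp add: one_ereal_def)
  define x where "x = (2::real) powr r"
  have x: "1 + r \<le> x" using one_add_mult_le_powr[of r 1] r by (simp add: x_def)
  then have "(1 + r) * 3 \<le> x * (2 * x - 1)" using r by (intro mult_mono) auto
  then have "1 / x \<le> (2 * x - 1) / (3 * (r + 1))" using r x by (simp add: field_simps)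
  then have "(1 / x) powr (1 / r) \<le> ((2 * x - 1) / (3 * (r + 1))) powr (1 / r)"
    using r x by (intro powr_mono2) auto
  moreover have "(1 / x) powr (1 / r) = 1 / 2" using r by (simp add: x_def powr_divide powr_powr)
  ultimately show ?thesis using real by (simp add: p_root_ereal x_def powr_add mult.commute)
qed (use assms p_root_infinity_simpson in auto)

section \<open>Logarithms of the means and their differences as moments\<close>

lemma ln_identric_mean:
  assumes "0 < a" "a < b"
  shows "ln (identric_mean a b) = (b * ln b - a * ln a) / (b - a) - 1"
  unfolding identric_mean_def using assms
  by (simp add: ln_mult ln_div ln_powr)

lemma ln_geometric_mean:
  assumes "0 < a" "0 < b"
  shows "ln (geometric_mean a b) = (ln a + ln b) / 2"
  unfolding geometric_mean_def using assms by (simp add: ln_sqrt ln_mult)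

theorem proposition5:
  fixes a b q :: real and p :: ereal
  assumes "0 < a" and "a < b"
    and "1 \<le> q" and "1 \<le> p" and "1 / p + 1 / ereal q = 1"
  shows "\<bar>ln (arithmetic_mean a b) - ln (identric_mean a b)\<bar>
           \<le> (b - a)\<^sup>2 / 16 * p_root (\<lambda>s. 1 / (s + 1)) p
              * (1 / (2 * (q + 2))) powr (1 / q) * S_sum q a b
       \<and> \<bar>ln (geometric_mean a b) - ln (identric_mean a b)\<bar>
           \<le> (b - a)\<^sup>2 / 16 * p_root (\<lambda>s. (2 powr (s + 1) - 1) / (s + 1)) p
              * (1 / (2 * (q + 2))) powr (1 / q) * S_sum q a b
       \<and> \<bar>1 / 3 * ln (geometric_mean a b) + 2 / 3 * ln (arithmetic_mean a b)
             - ln (identric_mean a b)\<bar>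
           \<le> (b - a)\<^sup>2 / 48 * p_root (\<lambda>s. (2 powr (s + 1) - 1) / (3 * (s + 1))) p
              * (1 / (2 * (q + 2))) powr (1 / q) * S_sum q a b"
proof -
  note ab = assms(1,2) and pq = assms(3-5)
  have b: "0 < b" "a \<noteq> b" "b \<noteq> a" using ab by auto
  define h where "h = (b - a) / 2"
  \<comment> \<open>First and second moments of 1/x^2 along the half starting at \<open>c\<close>;
    all three kernels are combinations of t and t^2.\<close>
  define I1 :: "real \<Rightarrow> real \<Rightarrow> real" where "I1 = (\<lambda>c e. (ln ((c + e) / 2) - ln c + 2 * c / (c + e) - 1) / ((e - c) / 2)\<^sup>2)"
  define I2 :: "real \<Rightarrow> real \<Rightarrow> real" where "I2 = (\<lambda>c e. (1 + 2 * c / (c + e)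
      - 2 * c * (ln ((c + e) / 2) - ln c) / ((e - c) / 2)) / ((e - c) / 2)\<^sup>2)"
  define B where "B = (1 / (2 * (q + 2))) powr (1 / q) * S_sum q a b"
  have B: "B = half_bound q a b + half_bound q b a" by (simp only: B_def S_sum_half_bound)
  have i1: "((\<lambda>t. t / (half_segment c e t)\<^sup>2) has_integral I1 c e) {0..1}"
    and i2: "((\<lambda>t. t\<^sup>2 / (half_segment c e t)\<^sup>2) has_integral I2 c e) {0..1}"
    if "0 < c" "0 < e" "c \<noteq> e" for c e
    using has_integral_half_segment_1[OF that] has_integral_half_segment_2[OF that]
    by (simp_all add: I1_def I2_def)
  have h: "h > 0" "((b - a) / 2)\<^sup>2 = h\<^sup>2" "((a - b) / 2)\<^sup>2 = h\<^sup>2" "b - a = 2 * h"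
    "(b - a) / 2 = h" "(a - b) / 2 = - h"
    using ab by (auto simp: h_def power2_eq_square field_simps)

  have ab_sum: "2 * a / (a + b) + 2 * b / (a + b) = 2"
    using ab by (simp add: add_divide_distrib[symmetric] distrib_left[symmetric] del: distrib_left_numeral)
  have sum1: "h\<^sup>2 / 2 * (I1 a b + I1 b a) = ln (arithmetic_mean a b) - ln (geometric_mean a b)"
  proof -
    have "I1 a b + I1 b a = (2 * ln ((a + b) / 2) - ln a - ln b + (2 * a / (a + b) + 2 * b / (a + b)) - 2) / h\<^sup>2"
      unfolding I1_def h by (simp add: add_divide_distrib[symmetric] add.commute[of b a])
    also note ab_sum
    finally show ?thesis
      using h(1) ab by (simp add: ln_geometric_mean arithmetic_mean_def field_simps)
  qed
  have sum2: "h\<^sup>2 / 4 * (I2 a b + I2 b a) = ln (arithmetic_mean a b) - ln (identric_mean a b)"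
  proof -
    define L where "L = ln ((a + b) / 2)"
    \<comment> \<open>The paths from \<open>a\<close> and from \<open>b\<close> have slopes
      \<open>h\<close> and \<open>- h\<close>; this sign change makes the logarithms combine to b ln
      b - a ln a.\<close>
    have "h\<^sup>2 * (I2 a b + I2 b a) = (1 + 2 * a / (a + b) - 2 * a * (L - ln a) / h)
        + (1 + 2 * b / (a + b) + 2 * b * (L - ln b) / h)"
    proof -
      have "h\<^sup>2 * (x / h\<^sup>2 + y / h\<^sup>2) = x + y" for x y
        using h(1) by (simp add: distrib_left)
      then show ?thesis unfolding I2_def h L_def by (simp add: add.commute[of b a])
    qed
    also have "\<dots> = 2 + (2 * a / (a + b) + 2 * b / (a + b))
        + (2 * (b - a) * L - 2 * (b * ln b - a * ln a)) / h"
      using h(1) by (simp add: field_simps)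
    also note ab_sum
    also have "2 + 2 + (2 * (b - a) * L - 2 * (b * ln b - a * ln a)) / h
        = 4 * (L - ((b * ln b - a * ln a) / (b - a) - 1))"
      unfolding h(4) using h(1) by (simp add: field_simps)
    finally show ?thesis
      using ab by (simp add: ln_identric_mean arithmetic_mean_def L_def)
  qed

  \<comment> \<open>Bounds for the three kernels on each half\<close>
  have mid: "I2 c e \<le> p_root (\<lambda>s. 1 / (s + 1)) p * half_bound q c e"
    and mid0: "0 \<le> I2 c e" if "0 < c" "0 < e" "c \<noteq> e" for c e
  proof -
    show "0 \<le> I2 c e" by (rule has_integral_nonneg[OF i2[OF that]]) auto
    show "I2 c e \<le> p_root (\<lambda>s. 1 / (s + 1)) p * half_bound q c e"
    proof (rule half_segment_p_root_bound[OF that(1,2) pq, of "\<lambda>t. t"])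
      show "((\<lambda>t. t * (t / (half_segment c e t)\<^sup>2)) has_integral I2 c e) {0..1}"
        using i2[OF that] by (simp add: power2_eq_square)
      show "((\<lambda>t. t powr s) has_integral 1 / (s + 1)) {0..1}" if "s > 1" for s :: real
        using has_integral_affine_powr[of s 1 0] that by simp
    qed (auto simp: p_root_infinity_midpoint)
  qed
  \<comment> \<open>The kernel 2 - t is nonnegative on [0, 1], with maximum 2 equal to the p-factor
    at infinity.\<close>
  have trap: "2 * I1 c e - I2 c e \<le> p_root (\<lambda>s. (2 powr (s + 1) - 1) / (s + 1)) p * half_bound q c e"
    and trap0: "0 \<le> 2 * I1 c e - I2 c e" if "0 < c" "0 < e" "c \<noteq> e" for c e
  proof -
    have i: "((\<lambda>t. (2 - t) * (t / (half_segment c e t)\<^sup>2)) has_integral 2 * I1 c e - I2 c e) {0..1}"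
      using has_integral_diff[OF has_integral_mult_right[OF i1[OF that], of 2] i2[OF that]]
      by (simp add: algebra_simps diff_divide_distrib power2_eq_square)
    show "0 \<le> 2 * I1 c e - I2 c e" by (rule has_integral_nonneg[OF i]) auto
    show "2 * I1 c e - I2 c e \<le> p_root (\<lambda>s. (2 powr (s + 1) - 1) / (s + 1)) p * half_bound q c e"
    proof (rule half_segment_p_root_bound[OF that(1,2) pq _ i])
      show "((\<lambda>t. (2 - t) powr s) has_integral (2 powr (s + 1) - 1) / (s + 1)) {0..1}"
        if "s > 1" for s :: real
        using has_integral_affine_powr[of s "-1" 2] that
        by (simp add: minus_divide_left del: minus_add_distrib)
      show "0 < (2 powr (s + 1) - 1) / (s + 1)" if "s > 1" for s :: real
        using that by (simp add: powr_mono[of 0 "s+1" 2, simplified])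
    qed (auto simp: p_root_infinity_trapezoid)
  qed
  \<comment> \<open>The kernel 2 - 3 t changes sign, so the absolute value is bounded through its
    mean-zero property instead of Hoelder.\<close>
  have simpson: "\<bar>2 * I1 c e - 3 * I2 c e\<bar> \<le> \<bar>1 / c\<^sup>2 - 1 / ((c + e) / 2)\<^sup>2\<bar> / 4"
    if "0 < c" "0 < e" "c \<noteq> e" for c e
  proof (rule half_segment_Simpson_bound[OF that(1,2)])
    show "((\<lambda>t. (2 - 3 * t) * (t / (half_segment c e t)\<^sup>2)) has_integral 2 * I1 c e - 3 * I2 c e) {0..1}"
      using has_integral_diff[OF has_integral_mult_right[OF i1[OF that], of 2]
          has_integral_mult_right[OF i2[OF that], of 3]]
      by (simp add: algebra_simps diff_divide_distrib power2_eq_square)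
  qed

  \<comment> \<open>Midpoint and trapezoid estimates\<close>
  have "\<bar>ln (arithmetic_mean a b) - ln (identric_mean a b)\<bar> = h\<^sup>2 / 4 * (I2 a b + I2 b a)"
    unfolding sum2[symmetric] using mid0 ab b by (intro abs_of_nonneg) auto
  also have "\<dots> \<le> h\<^sup>2 / 4 * (p_root (\<lambda>s. 1 / (s + 1)) p * B)"
    unfolding B distrib_left[of "p_root _ _"] using ab b by (intro mult_left_mono add_mono mid) auto
  finally have 1: "\<bar>ln (arithmetic_mean a b) - ln (identric_mean a b)\<bar>
      \<le> h\<^sup>2 / 4 * (p_root (\<lambda>s. 1 / (s + 1)) p * B)" .

  \<comment> \<open>Subtract \<open>sum2\<close> from \<open>sum1\<close>.\<close>
  have "ln (identric_mean a b) - ln (geometric_mean a b)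
      = h\<^sup>2 / 4 * ((2 * I1 a b - I2 a b) + (2 * I1 b a - I2 b a))"
    using sum1 sum2 by (simp add: field_simps)
  moreover have "\<dots> \<ge> 0" using trap0 ab b by (auto intro!: mult_nonneg_nonneg add_nonneg_nonneg)
  ultimately have "\<bar>ln (geometric_mean a b) - ln (identric_mean a b)\<bar>
      = h\<^sup>2 / 4 * ((2 * I1 a b - I2 a b) + (2 * I1 b a - I2 b a))" by linarith
  also have "\<dots> \<le> h\<^sup>2 / 4 * (p_root (\<lambda>s. (2 powr (s + 1) - 1) / (s + 1)) p * B)"
    unfolding B distrib_left[of "p_root _ _"] using ab b by (intro mult_left_mono add_mono trap) auto
  finally have 2: "\<bar>ln (geometric_mean a b) - ln (identric_mean a b)\<bar>
      \<le> h\<^sup>2 / 4 * (p_root (\<lambda>s. (2 powr (s + 1) - 1) / (s + 1)) p * B)" .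

  \<comment> \<open>Simpson-type estimate\<close>
  let ?N = "p_root (\<lambda>s. (2 powr (s + 1) - 1) / (3 * (s + 1))) p"
  have N: "1 / 2 \<le> ?N" using pq by (intro p_root_Simpson_ge)
  have "\<bar>(2 * I1 a b - 3 * I2 a b) + (2 * I1 b a - 3 * I2 b a)\<bar>
      \<le> (1 / a\<^sup>2 - 1 / b\<^sup>2) / 4"
  proof -
    have "1 / ((a + b) / 2)\<^sup>2 \<le> 1 / a\<^sup>2" "1 / b\<^sup>2 \<le> 1 / ((a + b) / 2)\<^sup>2"
      using ab by (auto intro!: frac_le power_mono)
    \<comment> \<open>The value \<open>M\<close> of 1/x^2 at the midpoint lies between the endpoint
      values, so the bounds for the two halves telescope.\<close>
    moreover have "\<bar>x + y\<bar> \<le> (A - B) / 4"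
      if "M \<le> A" "B \<le> M" "\<bar>x\<bar> \<le> \<bar>A - M\<bar> / 4" "\<bar>y\<bar> \<le> \<bar>B - M\<bar> / 4"
      for x y A B M :: real
      using that by (simp add: abs_if split: if_splits)
    ultimately show ?thesis
      using simpson[OF ab(1) b(1,2)] simpson[OF b(1) ab(1) b(3)]
      unfolding add.commute[of b a] by blast
  qed
  also have "\<dots> \<le> (1 / 2) * (1 / (3 * a\<^sup>2) + 1 / (6 * a\<^sup>2))" using ab by (simp add: field_simps)
  \<comment> \<open>The half at \<open>a\<close> supplies 1/(3 a^2), the half at \<open>b\<close>
    supplies 1/(6 a^2), and \<open>N\<close> supplies 1/2.\<close>
  also have "\<dots> \<le> ?N * B"
    unfolding B using half_bound_ge(1)[of a b q] half_bound_ge(2)[of b a q] ab b pq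
    by (intro mult_mono N add_mono order_trans[OF _ N]) auto
  finally have "h\<^sup>2 / 12 * \<bar>(2 * I1 a b - 3 * I2 a b) + (2 * I1 b a - 3 * I2 b a)\<bar> \<le> h\<^sup>2 / 12 * (?N * B)"
    by (intro mult_left_mono) auto
  also have "h\<^sup>2 / 12 * \<bar>(2 * I1 a b - 3 * I2 a b) + (2 * I1 b a - 3 * I2 b a)\<bar>
      = \<bar>h\<^sup>2 / 12 * ((2 * I1 a b - 3 * I2 a b) + (2 * I1 b a - 3 * I2 b a))\<bar>"
    by (simp add: abs_mult)
  \<comment> \<open>A third of \<open>sum1\<close> minus \<open>sum2\<close>.\<close>
  also have "h\<^sup>2 / 12 * ((2 * I1 a b - 3 * I2 a b) + (2 * I1 b a - 3 * I2 b a))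
      = - (1 / 3 * ln (geometric_mean a b) + 2 / 3 * ln (arithmetic_mean a b) - ln (identric_mean a b))"
    using sum1 sum2 by (simp add: field_simps)
  finally have 3: "\<bar>1 / 3 * ln (geometric_mean a b) + 2 / 3 * ln (arithmetic_mean a b)
      - ln (identric_mean a b)\<bar> \<le> h\<^sup>2 / 12 * (?N * B)" unfolding abs_minus_cancel .

  have "(b - a)\<^sup>2 / 16 = h\<^sup>2 / 4" "(b - a)\<^sup>2 / 48 = h\<^sup>2 / 12"
    unfolding h(4) by (simp_all add: power2_eq_square)
  then show ?thesis using 1 2 3 unfolding B_def by (simp only: mult.assoc)
qed

end
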